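(* Let $\mathcal M=\{A,B,C,D\}$ be a minimal discrete-time system with $A\in\mathbb C^{n\times n}$, $B\in\mathbb C^{n\times m}$, $C\in\mathbb C^{m\times n}$, $D\in\mathbb C^{m\times m}$ and $\operatorname{rank}B=\operatorname{rank}C=m$, put $R:=D+D^{\mathsf H}$, and assume that the set $$\mathbb X_d:=\{X=X^{\mathsf H}\in\mathbb C^{n\times n} : W_d(X)\succ 0,\ X\succ 0\}$$ is non-empty. For $X\in\mathbb X_d$ define $$F_d:=(R-B^{\mathsf H}XB)^{-1}(C-B^{\mathsf H}XA),\qquad P_d:=X-A^{\mathsf H}XA-F_d^{\mathsf H}(R-B^{\mathsf H}XB)F_d,\qquad A_{F_d}:=A-BF_d .$$ Then $X\in\mathbb X_d$ is the analytic center of $\mathbb X_d$ if and only if $$A_{F_d}P_d^{-1}A_{F_d}^{\mathsf H}-P_d^{-1}+B(R-B^{\mathsf H}XB)^{-1}B^{\mathsf H}=0 .$$ Moreover, at the analytic center all eigenvalues of $A_{F_d}$ lie strictly inside the unit circle.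
   Context: $V^{\mathsf H}$ denotes the conjugate transpose; $\succ 0$ means Hermitian positive definite. The system $\{A,B,C,D\}$ is minimal if $\operatorname{rank}[\lambda I-A\ \ B]=n$ for all $\lambda\in\mathbb C$ (controllability of $(A,B)$) and $(A^{\mathsf H},C^{\mathsf H})$ is controllable. For Hermitian $X\in\mathbb C^{n\times n}$, $$W_d(X):=\begin{bmatrix}X-A^{\mathsf H}XA & C^{\mathsf H}-A^{\mathsf H}XB\\ C-B^{\mathsf H}XA & R-B^{\mathsf H}XB\end{bmatrix},\qquad R=D+D^{\mathsf H}.$$ The analytic center of $\mathbb X_d$ is the minimizer over $\mathbb X_d$ of the barrier function $-\ln\det W_d(X)$. *)

theory Defs
  imports "HOL-Analysis.Analysis"
begin

definition ctranspose :: "complex^'n^'m \<Rightarrow> complex^'m^'n" where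
  "ctranspose V = (\<chi> i j. cnj (V $ j $ i))"

definition hermitian :: "complex^'n^'n \<Rightarrow> bool" where
  "hermitian M \<longleftrightarrow> ctranspose M = M"

text \<open>For Hermitian \<open>M\<close> the number \<open>x\<^sup>H M x\<close> is real, so taking its real part loses nothing.\<close>

definition pos_def :: "complex^'n^'n \<Rightarrow> bool" where
  "pos_def M \<longleftrightarrow> hermitian M \<and>
     (\<forall>x. x \<noteq> 0 \<longrightarrow> 0 < Re (\<Sum>i\<in>UNIV. cnj (x $ i) * (M *v x) $ i))"

definition eigenvalue :: "complex^'n^'n \<Rightarrow> complex \<Rightarrow> bool" where
  "eigenvalue M z \<longleftrightarrow> (\<exists>v. v \<noteq> 0 \<and> M *v v = z *s v)"

text \<open>Block matrices are indexed by sum types: \<open>Inl\<close> is the first block, \<open>Inr\<close> the second.\<close>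

definition hblock :: "'a^'n^'k \<Rightarrow> 'a^'m^'k \<Rightarrow> 'a^('n + 'm)^'k" where
  "hblock M N = (\<chi> i j. case j of Inl k \<Rightarrow> M $ i $ k | Inr l \<Rightarrow> N $ i $ l)"

definition vblock :: "'a^'k^'n \<Rightarrow> 'a^'k^'m \<Rightarrow> 'a^'k^('n + 'm)" where
  "vblock M N = (\<chi> i. case i of Inl k \<Rightarrow> M $ k | Inr l \<Rightarrow> N $ l)"

definition controllable :: "complex^'n^'n \<Rightarrow> complex^'m^'n \<Rightarrow> bool" where
  "controllable A B \<longleftrightarrow> (\<forall>z. rank (hblock (mat z - A) B) = CARD('n))"

definition minimal_system ::
  "complex^'n^'n \<Rightarrow> complex^'m^'n \<Rightarrow> complex^'n^'m \<Rightarrow> complex^'m^'m \<Rightarrow> bool" where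
  "minimal_system A B C D \<longleftrightarrow>
     controllable A B \<and> controllable (ctranspose A) (ctranspose C)"

definition R_mat :: "complex^'m^'m \<Rightarrow> complex^'m^'m" where
  "R_mat D = D + ctranspose D"

definition W_d :: "complex^'n^'n \<Rightarrow> complex^'m^'n \<Rightarrow> complex^'n^'m \<Rightarrow> complex^'m^'m
    \<Rightarrow> complex^'n^'n \<Rightarrow> complex^('n + 'm)^('n + 'm)" where
  "W_d A B C D X = vblock
     (hblock (X - ctranspose A ** X ** A) (ctranspose C - ctranspose A ** X ** B))
     (hblock (C - ctranspose B ** X ** A) (R_mat D - ctranspose B ** X ** B))"

definition X_d :: "complex^'n^'n \<Rightarrow> complex^'m^'n \<Rightarrow> complex^'n^'m \<Rightarrow> complex^'m^'m
    \<Rightarrow> (complex^'n^'n) set" where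
  "X_d A B C D = {X. hermitian X \<and> pos_def (W_d A B C D X) \<and> pos_def X}"

text \<open>On \<open>X_d\<close> the matrix \<open>W_d\<close> is Hermitian positive definite, so its determinant is a
  positive real number.\<close>

definition barrier_d :: "complex^'n^'n \<Rightarrow> complex^'m^'n \<Rightarrow> complex^'n^'m \<Rightarrow> complex^'m^'m
    \<Rightarrow> complex^'n^'n \<Rightarrow> real" where
  "barrier_d A B C D X = - ln (Re (det (W_d A B C D X)))"

definition analytic_center_d :: "complex^'n^'n \<Rightarrow> complex^'m^'n \<Rightarrow> complex^'n^'m
    \<Rightarrow> complex^'m^'m \<Rightarrow> complex^'n^'n \<Rightarrow> bool" where
  "analytic_center_d A B C D X \<longleftrightarrow>
     is_arg_min (barrier_d A B C D) (\<lambda>Y. Y \<in> X_d A B C D) X"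

definition F_d :: "complex^'n^'n \<Rightarrow> complex^'m^'n \<Rightarrow> complex^'n^'m \<Rightarrow> complex^'m^'m
    \<Rightarrow> complex^'n^'n \<Rightarrow> complex^'n^'m" where
  "F_d A B C D X =
     matrix_inv (R_mat D - ctranspose B ** X ** B) ** (C - ctranspose B ** X ** A)"

definition P_d :: "complex^'n^'n \<Rightarrow> complex^'m^'n \<Rightarrow> complex^'n^'m \<Rightarrow> complex^'m^'m
    \<Rightarrow> complex^'n^'n \<Rightarrow> complex^'n^'n" where
  "P_d A B C D X = X - ctranspose A ** X ** A
     - ctranspose (F_d A B C D X) ** (R_mat D - ctranspose B ** X ** B) ** F_d A B C D X"

definition A_F_d :: "complex^'n^'n \<Rightarrow> complex^'m^'n \<Rightarrow> complex^'n^'m \<Rightarrow> complex^'m^'m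
    \<Rightarrow> complex^'n^'n \<Rightarrow> complex^'n^'n" where
  "A_F_d A B C D X = A - B ** F_d A B C D X"

end

theory Submission
  imports Defs "HOL-Computational_Algebra.Fundamental_Theorem_Algebra"
begin

text \<open>
  Along a line \<open>W + t L\<close> with \<open>W\<close> positive definite and \<open>L\<close> Hermitian the determinant factors as
  \<open>det W * \<Prod> (1 + t \<mu>)\<close> with real \<open>\<mu>\<close> (roots of \<open>det (W + t L)\<close> are real), and by Jacobi's formula
  \<open>\<Sum> \<mu> = trace (W\<^sup>-\<^sup>1 L)\<close>. Since \<open>ln (1 + \<mu>) \<le> \<mu>\<close>, a point of \<open>X_d\<close> is the analytic center iff
  \<open>trace (W\<^sup>-\<^sup>1 L)\<close> vanishes for every direction. For a direction \<open>\<Delta>\<close> of \<open>X\<close> this trace is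
  \<open>- trace (G \<Delta>)\<close>, with \<open>G\<close> the left-hand side of the claimed equation, so testing with
  \<open>\<Delta> = G\<close> gives \<open>G = 0\<close>. Finally, for a left eigenvector \<open>w\<close> of \<open>A_F\<close>, \<open>w\<^sup>H G w = 0\<close> reads
  \<open>(1 - \<bar>z\<bar>\<^sup>2) w\<^sup>H P\<^sup>-\<^sup>1 w = w\<^sup>H B S\<^sup>-\<^sup>1 B\<^sup>H w\<close>, where \<open>S = R - B\<^sup>H X B\<close>, and controllability
  excludes \<open>B\<^sup>H w = 0\<close>.
\<close>

section \<open>Hermitian matrices and the standard inner product\<close>

lemma ctranspose_ctranspose [simp]: "ctranspose (ctranspose M) = M"
  by (simp add: ctranspose_def vec_eq_iff)

lemma ctranspose_add: "ctranspose (M + N) = ctranspose M + ctranspose N"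
  by (simp add: ctranspose_def vec_eq_iff)

lemma ctranspose_diff: "ctranspose (M - N) = ctranspose M - ctranspose N"
  by (simp add: ctranspose_def vec_eq_iff)

lemma ctranspose_uminus: "ctranspose (- M) = - ctranspose M"
  by (simp add: ctranspose_def vec_eq_iff)

lemma ctranspose_0 [simp]: "ctranspose 0 = 0"
  by (simp add: ctranspose_def vec_eq_iff)

lemma ctranspose_mat_1 [simp]: "ctranspose (mat 1) = mat 1"
  by (simp add: ctranspose_def mat_def vec_eq_iff)

lemma ctranspose_scaleR: "ctranspose (t *\<^sub>R M) = t *\<^sub>R ctranspose M"
  by (simp add: ctranspose_def vec_eq_iff)

lemma ctranspose_mul: "ctranspose (M ** N) = ctranspose N ** ctranspose M"
  by (simp add: ctranspose_def matrix_matrix_mult_def vec_eq_iff mult.commute)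

lemma matrix_add_rdistrib: "((M :: 'a::ring_1^'k^'l) + M') ** N = M ** N + M' ** N"
  by (simp add: matrix_matrix_mult_def vec_eq_iff algebra_simps sum.distrib)

lemma matrix_diff_ldistrib: "(M :: 'a::ring_1^'k^'l) ** (N - N') = M ** N - M ** N'"
  by (simp add: matrix_matrix_mult_def vec_eq_iff algebra_simps sum_subtractf)

lemma matrix_diff_rdistrib: "((M :: 'a::ring_1^'k^'l) - M') ** N = M ** N - M' ** N"
  by (simp add: matrix_matrix_mult_def vec_eq_iff algebra_simps sum_subtractf)

lemma matrix_scaleR_mult: "M ** (t *\<^sub>R N) = t *\<^sub>R (M ** N)" "(t *\<^sub>R N) ** H = t *\<^sub>R (N ** H)"
  for M :: "complex^'b^'a" and N :: "complex^'c^'b" and H :: "complex^'d^'c"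
  by (simp_all add: matrix_matrix_mult_def vec_eq_iff scaleR_sum_right)

lemma matrix_minus_right: "(M :: 'a::ring_1^'k^'l) ** (- N) = - (M ** N)"
  by (simp add: matrix_matrix_mult_def vec_eq_iff sum_negf)

lemma matrix_zero_right [simp]: "(M :: 'a::ring_1^'k^'l) ** 0 = 0"
  by (simp add: matrix_matrix_mult_def vec_eq_iff)

lemma matrix_zero_left [simp]: "(0 :: 'a::ring_1^'k^'l) ** N = 0"
  by (simp add: matrix_matrix_mult_def vec_eq_iff)

definition cinner :: "complex^'k \<Rightarrow> complex^'k \<Rightarrow> complex" where
  "cinner x y = (\<Sum>i\<in>UNIV. cnj (x $ i) * y $ i)"

lemma cinner_adjoint: "cinner x (M *v y) = cinner (ctranspose M *v x) y"
proof -
  have "cinner x (M *v y) = (\<Sum>i\<in>UNIV. \<Sum>j\<in>UNIV. cnj (x $ i) * (M $ i $ j * y $ j))"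
    by (simp add: cinner_def matrix_vector_mult_def sum_distrib_left)
  also have "\<dots> = (\<Sum>j\<in>UNIV. \<Sum>i\<in>UNIV. cnj (x $ i) * (M $ i $ j * y $ j))"
    by (rule sum.swap)
  also have "\<dots> = cinner (ctranspose M *v x) y"
    by (simp add: cinner_def matrix_vector_mult_def ctranspose_def sum_distrib_right sum_distrib_left mult_ac)
  finally show ?thesis .
qed

lemma cinner_add_right: "cinner x (y + z) = cinner x y + cinner x z"
  by (simp add: cinner_def algebra_simps sum.distrib)

lemma cinner_diff_right: "cinner x (y - z) = cinner x y - cinner x z"
  by (simp add: cinner_def algebra_simps sum_subtractf)

lemma cinner_smult_right: "cinner x (c *s y) = c * cinner x y"
  by (simp add: cinner_def sum_distrib_left mult_ac)

lemma cinner_smult_left: "cinner (c *s x) y = cnj c * cinner x y"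
  by (simp add: cinner_def sum_distrib_left mult_ac)

lemma cinner_scaleR_right: "cinner x (t *\<^sub>R y) = t *\<^sub>R cinner x y"
  by (simp add: cinner_def scaleR_sum_right)

lemma cnj_cinner: "cnj (cinner x y) = cinner y x"
  by (simp add: cinner_def mult.commute)

lemma hermitian_form_real:
  assumes "hermitian M"
  shows "cinner x (M *v x) = of_real (Re (cinner x (M *v x)))"
proof -
  have "cnj (cinner x (M *v x)) = cinner x (M *v x)"
    using assms by (simp add: cnj_cinner hermitian_def cinner_adjoint)
  then show ?thesis
    by (metis Reals_cnj_iff complex_is_Real_iff of_real_Re)
qed

lemma pos_def_cinner:
  "pos_def M \<longleftrightarrow> hermitian M \<and> (\<forall>x. x \<noteq> 0 \<longrightarrow> 0 < Re (cinner x (M *v x)))"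
  by (simp add: pos_def_def cinner_def)

lemma pos_def_hermitian: "pos_def M \<Longrightarrow> hermitian M"
  by (simp add: pos_def_def)

lemma hermitian_scaleR_add:
  "hermitian M \<Longrightarrow> hermitian N \<Longrightarrow> hermitian (M + t *\<^sub>R N)"
  by (simp add: hermitian_def ctranspose_add ctranspose_scaleR)

lemma scaleR_matrix_vector_complex: "(t *\<^sub>R N) *v x = t *\<^sub>R (N *v x)" for N :: "complex^'k^'l"
  by (simp add: matrix_vector_mult_def vec_eq_iff scaleR_sum_right)

lemma cinner_scaleR_add:
  "Re (cinner x ((M + t *\<^sub>R N) *v x)) = Re (cinner x (M *v x)) + t * Re (cinner x (N *v x))"
  by (simp add: matrix_vector_mult_add_rdistrib cinner_add_right cinner_scaleR_right
      scaleR_matrix_vector_complex)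

text \<open>At a fixed vector the form is affine in \<open>t\<close>, hence a convex combination of
  its two positive endpoint values.\<close>

lemma pos_def_segment:
  assumes "pos_def M" "pos_def (M + N)" "0 \<le> t" "t \<le> 1"
  shows "pos_def (M + t *\<^sub>R N)"
proof -
  have hN: "hermitian N"
    using assms(1,2) by (auto simp: pos_def_def hermitian_def ctranspose_add)
  have "0 < Re (cinner x ((M + t *\<^sub>R N) *v x))" if "x \<noteq> 0" for x
  proof -
    let ?a = "Re (cinner x (M *v x))" and ?b = "Re (cinner x ((M + N) *v x))"
    have a: "0 < ?a" and b: "0 < ?b" using assms(1,2) that by (auto simp: pos_def_cinner)
    have b_eq: "?b = ?a + Re (cinner x (N *v x))"
      using cinner_scaleR_add[of x M 1 N] by simp
    have e: "Re (cinner x ((M + t *\<^sub>R N) *v x)) = (1 - t) * ?a + t * ?b"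
      unfolding cinner_scaleR_add b_eq by (simp add: algebra_simps)
    show ?thesis
    proof (cases "t = 0")
      case True
      then show ?thesis using e a by simp
    next
      case False
      then have "0 < t * ?b" using b assms(3) by simp
      moreover have "0 \<le> (1 - t) * ?a" using a assms(4) by simp
      ultimately show ?thesis using e by linarith
    qed
  qed
  then show ?thesis
    using hermitian_scaleR_add[OF pos_def_hermitian[OF assms(1)] hN] by (simp add: pos_def_cinner)
qed

section \<open>Kernels, eigenvalues and inverses\<close>

lemma pos_def_invertible:
  assumes "pos_def M"
  shows "invertible M"
proof -
  have "x = 0" if "M *v x = 0" for x
    using assms that by (auto simp: pos_def_cinner cinner_def)
  then have "\<exists>B. B ** M = mat 1"
    by (subst matrix_left_invertible_ker) blast
  then show ?thesis
    by (simp add: invertible_left_inverse)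
qed

lemma singular_kernel:
  fixes M :: "'a::field^'k^'k"
  assumes "det M = 0"
  obtains x where "x \<noteq> 0" "M *v x = 0"
proof -
  have "\<not> (\<exists>B. B ** M = mat 1)"
    using assms invertible_det_nz invertible_left_inverse by blast
  then show thesis
    using that by (auto simp: matrix_left_invertible_ker)
qed

lemma mat_vector_mult: "mat z *v v = z *s v"
  by (simp add: vec_eq_iff mat_def matrix_vector_mult_def if_distrib[of "\<lambda>x. x * y" for y] cong: if_cong)

text \<open>The determinant criterion is stable under conjugate transposition, so an eigenvalue of a
  matrix can be traded for a left eigenvector.\<close>

lemma eigenvalue_iff_det:
  fixes M :: "complex^'k^'k"
  shows "eigenvalue M z \<longleftrightarrow> det (M - mat z) = 0"
proof -
  have *: "(M - mat z) *v v = M *v v - z *s v" for v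
    by (simp add: matrix_vector_mult_diff_rdistrib mat_vector_mult)
  show ?thesis
  proof
    assume "eigenvalue M z"
    then obtain v where "v \<noteq> 0" "(M - mat z) *v v = 0"
      by (auto simp: eigenvalue_def *)
    then show "det (M - mat z) = 0"
      by (metis invertible_det_nz invertible_left_inverse matrix_left_invertible_ker)
  next
    assume "det (M - mat z) = 0"
    then show "eigenvalue M z"
      by (metis "*" eigenvalue_def right_minus_eq singular_kernel)
  qed
qed

lemma det_ctranspose: "det (ctranspose M) = cnj (det M)"
proof -
  have "det (ctranspose M) = det (\<chi> i j. cnj (M $ i $ j))"
    by (subst det_transpose[symmetric]) (simp add: transpose_def ctranspose_def)
  also have "\<dots> = cnj (det M)"
    by (simp add: det_def)
  finally show ?thesis .
qed

lemma eigenvalue_ctranspose: "eigenvalue (ctranspose M) (cnj z)" if "eigenvalue M z"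
proof -
  have "ctranspose M - mat (cnj z) = ctranspose (M - mat z)"
    by (auto simp: ctranspose_def mat_def vec_eq_iff)
  then show ?thesis using that by (simp add: eigenvalue_iff_det det_ctranspose)
qed

lemma matrix_inv_mult:
  assumes "invertible (M :: 'a::field^'k^'k)"
  shows "M ** matrix_inv M = mat 1" "matrix_inv M ** M = mat 1"
  using assms matrix_inv_def[of M] unfolding invertible_def
  by (metis (mono_tags, lifting) someI_ex)+

lemma matrix_inv_unique:
  assumes "(M :: 'a::field^'k^'k) ** N = mat 1"
  shows "matrix_inv M = N"
proof -
  have "N ** M = mat 1" using assms matrix_left_right_inverse by blast
  then have "invertible M" using assms by (auto simp: invertible_def)
  then show ?thesis
    by (metis assms matrix_inv_mult(2) matrix_mul_assoc matrix_mul_lid matrix_mul_rid)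
qed

lemma hermitian_matrix_inv:
  assumes "hermitian M" "invertible M"
  shows "ctranspose (matrix_inv M) = matrix_inv M"
proof -
  have "M ** ctranspose (matrix_inv M) = mat 1"
    using arg_cong[OF matrix_inv_mult(2)[OF assms(2)], of ctranspose] assms(1)
    by (simp add: ctranspose_mul hermitian_def)
  then show ?thesis using matrix_inv_unique by metis
qed

text \<open>With \<open>y = matrix_inv M *v x\<close>, the form of the inverse at \<open>x\<close>
  equals the form of \<open>M\<close> at \<open>y\<close>.\<close>

lemma pos_def_matrix_inv:
  assumes "pos_def M"
  shows "pos_def (matrix_inv M)"
proof -
  let ?N = "matrix_inv M"
  have inv: "invertible M" using assms by (rule pos_def_invertible)
  have h: "ctranspose ?N = ?N"
    using hermitian_matrix_inv[OF pos_def_hermitian[OF assms] inv] .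
  have "0 < Re (cinner x (?N *v x))" if "x \<noteq> 0" for x
  proof -
    have x: "M *v (?N *v x) = x"
      by (simp add: matrix_vector_mul_assoc matrix_inv_mult[OF inv])
    then have "?N *v x \<noteq> 0" using that by force
    then have "0 < Re (cinner (?N *v x) (M *v (?N *v x)))"
      using assms by (simp add: pos_def_cinner)
    also have "cinner (?N *v x) (M *v (?N *v x)) = cinner x (?N *v x)"
      using x cinner_adjoint[of x ?N x] h by simp
    finally show ?thesis .
  qed
  then show ?thesis using h by (simp add: pos_def_cinner hermitian_def)
qed

text \<open>\<open>K\<close> may be rectangular; injectivity keeps \<open>K *v x\<close> nonzero.
  This later extracts positive definite blocks and Schur complements from \<open>W\<close>.\<close>

lemma pos_def_congruence:
  assumes "pos_def M" "\<And>x. K *v x = 0 \<Longrightarrow> x = 0"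
  shows "pos_def (ctranspose K ** M ** K)"
proof -
  have "cinner x ((ctranspose K ** M ** K) *v x) = cinner (K *v x) (M *v (K *v x))" for x
    using cinner_adjoint[of x "ctranspose K" "M *v (K *v x)"]
    by (simp add: matrix_vector_mul_assoc matrix_mul_assoc)
  then show ?thesis
    using assms by (auto simp: pos_def_cinner hermitian_def ctranspose_mul matrix_mul_assoc)
qed

section \<open>Determinants of Hermitian pencils\<close>

lemma mat_mult_nth: "(mat t ** N) $ i $ j = t * N $ i $ j" for N :: "'a::semiring_1^'l^'k"
  by (simp add: matrix_matrix_mult_def mat_def if_distrib[of "\<lambda>x. x * y" for y] cong: if_cong)

text \<open>Positive definiteness concerns real multiples \<open>t *\<^sub>R N\<close>, while roots
  of the determinant call for a complex parameter, written \<open>mat t ** N\<close>. This links the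
  two.\<close>

lemma mat_scaleR: "mat (of_real t) ** N = t *\<^sub>R N" for N :: "complex^'k^'k"
  by (simp add: vec_eq_iff mat_mult_nth scaleR_conv_of_real[where 'a = complex])

lemma poly_det: "poly (det P) t = det (\<chi> i j. poly (P $ i $ j) t)"
  by (simp add: det_def poly_sum poly_prod)

text \<open>Splits the polynomial into linear factors and normalises each one to be 1 at 0; the list
  \<open>xs\<close> carries the roots with multiplicity.\<close>

lemma poly_split_at_0:
  fixes p :: "'a::alg_closed_field poly"
  assumes "poly p 0 \<noteq> 0"
  obtains xs where "\<And>t. poly p t = poly p 0 * (\<Prod>x\<leftarrow>xs. 1 - t / x)"
    and "\<And>x. x \<in> set xs \<Longrightarrow> x \<noteq> 0 \<and> poly p x = 0"
proof -
  have "p \<noteq> 0" using assms by auto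
  then obtain M where M: "p = smult (lead_coeff p) (\<Prod>x\<in>#M. [:-x, 1:])"
    using alg_closed_imp_factorization by blast
  obtain xs where xs: "mset xs = M" using ex_mset by blast
  have "prod_mset (image_mset (\<lambda>x. [:-x, 1:]) M) = (\<Prod>x\<leftarrow>xs. [:-x, 1:])"
    by (simp add: xs[symmetric] prod_mset_prod_list flip: mset_map)
  with M have p: "p = smult (lead_coeff p) (\<Prod>x\<leftarrow>xs. [:-x, 1:])" by simp
  define c where "c = lead_coeff p"
  have eval: "poly (\<Prod>x\<leftarrow>ys. [:-x, 1:]) t = (\<Prod>x\<leftarrow>ys. t - x)" for t :: 'a and ys
    by (induction ys) (auto simp: algebra_simps)
  have pt: "poly p t = c * (\<Prod>x\<leftarrow>xs. t - x)" for t
    by (subst p) (simp add: c_def eval)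
  have root: "x \<noteq> 0 \<and> poly p x = 0" if "x \<in> set xs" for x
  proof -
    have "poly p x = 0"
      using that by (auto simp: pt prod_list_zero_iff)
    then show ?thesis using assms by auto
  qed
  have nz: "0 \<notin> set xs" using root by blast
  \<comment> \<open>Each factor is \<open>t - x = - x * (1 - t / x)\<close>; multiplied by
    \<open>c\<close>, the product of the \<open>- x\<close> is the value at 0.\<close>
  have "(\<Prod>x\<leftarrow>ys. t - x) = (\<Prod>x\<leftarrow>ys. - x) * (\<Prod>x\<leftarrow>ys. 1 - t / x)" if "0 \<notin> set ys" for t :: 'a and ys
    using that by (induction ys) (auto simp: field_simps)
  then have "poly p t = poly p 0 * (\<Prod>x\<leftarrow>xs. 1 - t / x)" for t
    using nz by (simp add: pt)
  with root show thesis by (rule that[rotated])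
qed

lemma DERIV_prod_list_at_0:
  fixes xs :: "'a::real_normed_field list"
  shows "((\<lambda>t. \<Prod>x\<leftarrow>xs. 1 + t * x) has_field_derivative sum_list xs) (at 0)"
proof (induction xs)
  case Nil
  then show ?case by simp
next
  case (Cons a xs)
  show ?case
    by (auto intro!: derivative_eq_intros Cons.IH simp: add.commute) (induction xs; simp)
qed

text \<open>Jacobi's formula at the identity. In the Leibniz expansion only the identity permutation
  has a nonzero derivative at 0.\<close>

lemma DERIV_det_at_mat_1:
  fixes M :: "'a::real_normed_field^'k^'k"
  shows "((\<lambda>t. det (mat 1 + mat t ** M)) has_field_derivative trace M) (at 0)"
proof -
  let ?e = "\<lambda>i j t. (if i = j then 1 else 0) + t * M $ i $ j"
  have det: "det (mat 1 + mat t ** M) =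
      (\<Sum>p\<in>{p. p permutes UNIV}. of_int (sign p) * (\<Prod>i\<in>UNIV. ?e i (p i) t))" for t
    by (simp add: det_def mat_mult_nth) (simp add: mat_def)
  have summand: "((\<lambda>t. of_int (sign p) * (\<Prod>i\<in>UNIV. ?e i (p i) t)) has_field_derivative
      (if p = id then trace M else 0)) (at 0)" if p: "p permutes (UNIV :: 'k set)" for p
  proof -
    have d: "((\<lambda>t. \<Prod>i\<in>UNIV. ?e i (p i) t) has_field_derivative
        (\<Sum>i\<in>UNIV. M $ i $ (p i) * (\<Prod>j\<in>UNIV - {i}. ?e j (p j) 0))) (at 0)"
      by (rule has_field_derivative_prod) (auto intro!: derivative_eq_intros)
    show ?thesis
    proof (cases "p = id")
      case True
      have "(\<Sum>i\<in>UNIV. M $ i $ (p i) * (\<Prod>j\<in>UNIV - {i}. ?e j (p j) 0)) = trace M"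
        using True by (simp add: trace_def)
      then show ?thesis using d True by (simp add: sign_id)
    next
      case False
      then obtain k where k: "p k \<noteq> k" by (auto simp: fun_eq_iff)
      \<comment> \<open>A permutation other than the identity moves both \<open>k\<close> and
        \<open>p k\<close>. Whichever factor the product rule differentiates, an off-diagonal factor
        remains, and it vanishes at 0.\<close>
      have k2: "p (p k) \<noteq> p k"
        using k p by (metis permutes_inverses(2))
      have "(\<Prod>j\<in>UNIV - {i}. ?e j (p j) 0) = 0" for i
      proof -
        obtain j where "j \<noteq> i" "p j \<noteq> j"
          using k k2 by metis
        then show ?thesis by (intro prod_zero) (auto intro!: bexI[of _ j])
      qed
      then have "(\<Sum>i\<in>UNIV. M $ i $ (p i) * (\<Prod>j\<in>UNIV - {i}. ?e j (p j) 0)) = 0"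
        by (simp only: mult_zero_right sum.neutral_const)
      with DERIV_cmult[OF d, of "of_int (sign p)"] False show ?thesis by simp
    qed
  qed
  have "((\<lambda>t. \<Sum>p\<in>{p. p permutes UNIV}. of_int (sign p) * (\<Prod>i\<in>UNIV. ?e i (p i) t))
      has_field_derivative (\<Sum>p\<in>{p. p permutes (UNIV :: 'k set)}. if p = id then trace M else 0)) (at 0)"
    using summand by (intro DERIV_sum) auto
  also have "(\<Sum>p\<in>{p. p permutes (UNIV :: 'k set)}. if p = id then trace M else 0) = trace M"
    by (simp add: permutes_id)
  finally show ?thesis by (simp only: det)
qed

text \<open>The list \<open>\<mu>\<close> holds the negative reciprocals of the roots of
  \<open>det (W + t L)\<close>, that is, the nonzero eigenvalues of \<open>matrix_inv W ** L\<close>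
  with multiplicity.\<close>

lemma pencil_factorization:
  fixes W L :: "complex^'k^'k"
  assumes W: "pos_def W" and L: "hermitian L"
  obtains \<mu> :: "real list" where
    "\<And>t. det (W + mat t ** L) = det W * (\<Prod>m\<leftarrow>\<mu>. 1 + t * of_real m)"
    and "of_real (sum_list \<mu>) = trace (matrix_inv W ** L)"
proof -
  have invW: "invertible W" using W by (rule pos_def_invertible)
  then have detW: "det W \<noteq> 0" by (simp add: invertible_det_nz)
  \<comment> \<open>The entries are linear polynomials in \<open>t\<close>, so \<open>p\<close> is
    \<open>det (W + t L)\<close> as a polynomial; its constant term \<open>det W\<close> is
    nonzero.\<close>
  define p where "p = det (\<chi> i j. [:W $ i $ j, L $ i $ j:])"
  have p: "poly p t = det (W + mat t ** L)" for t
    unfolding p_def poly_det by (rule arg_cong[of _ _ det]) (simp add: vec_eq_iff mat_mult_nth)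
  have p0: "poly p 0 = det W"
    unfolding p_def poly_det by (rule arg_cong[of _ _ det]) (simp add: vec_eq_iff)
  obtain xs where xs: "\<And>t. poly p t = poly p 0 * (\<Prod>x\<leftarrow>xs. 1 - t / x)"
    and root: "\<And>x. x \<in> set xs \<Longrightarrow> x \<noteq> 0 \<and> poly p x = 0"
    using poly_split_at_0[of p] detW p0 by metis
  have real: "x \<in> \<real>" if "x \<in> set xs" for x
  proof -
    have "det (W + mat x ** L) = 0" using root[OF that] by (simp add: p)
    then obtain v where v: "v \<noteq> 0" "(W + mat x ** L) *v v = 0"
      by (rule singular_kernel)
    from v(2) have "W *v v + x *s (L *v v) = 0"
      by (simp add: matrix_vector_mult_add_rdistrib mat_vector_mult
          flip: matrix_vector_mul_assoc)
    \<comment> \<open>Pairing the kernel equation with \<open>v\<close> gives a real linear equation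
      for the root, with positive constant term \<open>a\<close>.\<close>
    then have "cinner v (W *v v + x *s (L *v v)) = 0"
      by (simp add: cinner_def)
    then have e: "cinner v (W *v v) + x * cinner v (L *v v) = 0"
      by (simp add: cinner_add_right cinner_smult_right)
    define a b where "a = Re (cinner v (W *v v))" and "b = Re (cinner v (L *v v))"
    have "0 < a" using W v(1) by (simp add: pos_def_cinner a_def)
    moreover have "of_real a + x * of_real b = 0"
      using e hermitian_form_real[OF L, of v] hermitian_form_real[OF pos_def_hermitian[OF W], of v]
      by (simp add: a_def b_def)
    ultimately have "x = of_real (- a / b)"
      by (cases "b = 0") (auto simp: field_simps add_eq_0_iff)
    then show ?thesis by (metis Reals_of_real)
  qed
  define \<mu> where "\<mu> = map (\<lambda>x. - 1 / Re x) xs"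
  have "(\<Prod>x\<leftarrow>ys. 1 - t / x) = (\<Prod>m\<leftarrow>map (\<lambda>x. - 1 / Re x) ys. 1 + t * of_real m)"
    if "\<forall>x\<in>set ys. x \<in> \<real>" for t and ys :: "complex list"
    using that
  proof (induction ys)
    case (Cons y ys)
    then have "1 - t / y = 1 + t * of_real (- 1 / Re y)"
      by (auto elim!: Reals_cases)
    with Cons show ?case by simp
  qed simp
  then have fac: "det (W + mat t ** L) = det W * (\<Prod>m\<leftarrow>\<mu>. 1 + t * of_real m)" for t
    using xs real by (simp add: p[symmetric] p0 \<mu>_def)
  \<comment> \<open>Dividing the factorization by \<open>det W\<close> gives a second expression for
    the same determinant; comparing derivatives at 0 identifies the sum of \<open>\<mu>\<close> with
    the trace.\<close>
  have "((\<lambda>t. det (mat 1 + mat t ** (matrix_inv W ** L)))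
      has_field_derivative trace (matrix_inv W ** L)) (at 0)"
    by (rule DERIV_det_at_mat_1)
  moreover have "det (mat 1 + mat t ** (matrix_inv W ** L)) = (\<Prod>m\<leftarrow>map of_real \<mu>. 1 + t * m)" for t
  proof -
    have "W ** (mat t ** K) = mat t ** (W ** K)" for K :: "complex^'k^'k"
      by (simp add: vec_eq_iff mat_mult_nth matrix_matrix_mult_def[of W] sum_distrib_left mult_ac)
    moreover have "W ** (matrix_inv W ** L) = L"
      by (simp add: matrix_mul_assoc matrix_inv_mult[OF invW])
    ultimately have "W ** (mat 1 + mat t ** (matrix_inv W ** L)) = W + mat t ** L"
      by (simp only: matrix_add_ldistrib matrix_mul_rid)
    then have "det W * det (mat 1 + mat t ** (matrix_inv W ** L)) = det (W + mat t ** L)"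
      by (simp flip: det_mul)
    then show ?thesis using detW by (simp add: fac o_def)
  qed
  ultimately have "((\<lambda>t. \<Prod>m\<leftarrow>map of_real \<mu>. 1 + t * m)
      has_field_derivative trace (matrix_inv W ** L)) (at 0)" by simp
  then have "trace (matrix_inv W ** L) = sum_list (map of_real \<mu>)"
    using DERIV_prod_list_at_0 DERIV_unique by blast
  also have "\<dots> = of_real (sum_list \<mu>)" by (induction \<mu>) auto
  finally show thesis using that fac by metis
qed


section \<open>Positivity of determinants along a line\<close>

lemma prod_list_pos: "(\<And>x. x \<in> set xs \<Longrightarrow> 0 < x) \<Longrightarrow> 0 < prod_list xs"
  for xs :: "'a::linordered_semidom list"
  by (induction xs) auto

text \<open>If a factor were nonpositive at \<open>t\<close>, it would vanish somewhere on the
  segment from \<open>W\<close> to \<open>W + t *\<^sub>R L\<close>. The determinant is nonzero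
  there, as all matrices on it are positive definite.\<close>

lemma pencil_factor_pos:
  fixes W L :: "complex^'k^'k"
  assumes W: "pos_def W" and WL: "pos_def (W + t *\<^sub>R L)"
    and fac: "\<And>t. det (W + mat t ** L) = det W * (\<Prod>m\<leftarrow>\<mu>. 1 + t * complex_of_real m)"
    and m: "m \<in> set \<mu>"
  shows "0 < 1 + t * m"
proof (rule ccontr)
  assume neg: "\<not> 0 < 1 + t * m"
  then have tm: "t * m \<le> -1" by simp
  \<comment> \<open>The point at which \<open>1 + s * t * m\<close> vanishes; it lies in the unit
    interval because \<open>t * m \<le> -1\<close>.\<close>
  define s where "s = - 1 / (t * m)"
  have s: "0 \<le> s" "s \<le> 1" "s * t * m = - 1"
    using tm by (auto simp: s_def field_simps)
  have "pos_def (W + s *\<^sub>R (t *\<^sub>R L))"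
    using pos_def_segment[OF W WL s(1,2)] .
  then have "det (W + mat (of_real (s * t)) ** L) \<noteq> 0"
    unfolding mat_scaleR by (simp add: invertible_det_nz[symmetric] pos_def_invertible)
  moreover have "1 + complex_of_real (s * t) * of_real m = 0"
    using s(3) by (simp flip: of_real_mult)
  then have "(\<Prod>m\<leftarrow>\<mu>. 1 + of_real (s * t) * complex_of_real m) = 0"
    using m by (auto simp: prod_list_zero_iff image_iff intro!: bexI[of _ m])
  ultimately show False by (simp add: fac)
qed

lemma pos_def_mat_1: "pos_def (mat 1 :: complex^'k^'k)"
proof -
  have "0 < Re (cinner x x)" if "x \<noteq> 0" for x :: "complex^'k"
  proof -
    have "\<exists>i. x $ i \<noteq> 0" using that by (simp add: vec_eq_iff)
    then obtain i where "x $ i \<noteq> 0" ..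
    then show ?thesis unfolding cinner_def Re_sum
      by (intro sum_pos2[of _ i]) (auto simp: complex_neq_0 simp flip: power2_eq_square)
  qed
  then show ?thesis by (simp add: pos_def_cinner hermitian_def)
qed

lemma of_real_prod_list: "of_real (prod_list xs) = prod_list (map of_real xs)"
  by (induction xs) auto

text \<open>Follows the pencil from the identity to \<open>M\<close> and reads off its positive
  factors at parameter 1.\<close>

lemma pos_def_det:
  assumes M: "pos_def M"
  shows "0 < Re (det M)" "det M = of_real (Re (det M))"
proof -
  let ?L = "M - mat 1"
  have L: "hermitian ?L"
    using M by (simp add: pos_def_def hermitian_def ctranspose_diff)
  obtain \<mu> :: "real list" where
    fac: "\<And>t. det (mat 1 + mat t ** ?L) = det (mat 1 :: complex^'a^'a) * (\<Prod>m\<leftarrow>\<mu>. 1 + t * of_real m)"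
    using pencil_factorization[OF pos_def_mat_1 L] by metis
  have pos: "0 < 1 + m" if "m \<in> set \<mu>" for m
    using pencil_factor_pos[OF pos_def_mat_1, where t = 1 and L = ?L, OF _ fac that] M by simp
  have "det M = of_real (\<Prod>m\<leftarrow>\<mu>. 1 + m)"
    using fac[of 1] by (simp add: of_real_prod_list o_def)
  moreover have "0 < (\<Prod>m\<leftarrow>\<mu>. 1 + m)"
    using pos by (intro prod_list_pos) auto
  ultimately show "0 < Re (det M)" "det M = of_real (Re (det M))" by auto
qed

text \<open>Real form of the factorization, from which the logarithmic inequality and the
  first-order condition both follow.\<close>

lemma pos_def_pencil:
  fixes W L :: "complex^'k^'k"
  assumes W: "pos_def W" and L: "hermitian L"
  obtains \<mu> :: "real list" where
    "\<And>t. pos_def (W + t *\<^sub>R L) \<Longrightarrow>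
      Re (det (W + t *\<^sub>R L)) = Re (det W) * (\<Prod>m\<leftarrow>\<mu>. 1 + t * m)"
    and "\<And>t m. pos_def (W + t *\<^sub>R L) \<Longrightarrow> m \<in> set \<mu> \<Longrightarrow> 0 < 1 + t * m"
    and "of_real (sum_list \<mu>) = trace (matrix_inv W ** L)"
proof -
  obtain \<mu> :: "real list" where
    fac: "\<And>t. det (W + mat t ** L) = det W * (\<Prod>m\<leftarrow>\<mu>. 1 + t * of_real m)"
    and tr: "of_real (sum_list \<mu>) = trace (matrix_inv W ** L)"
    by (rule pencil_factorization[OF W L]) blast
  have "det (W + t *\<^sub>R L) = of_real (Re (det W) * (\<Prod>m\<leftarrow>\<mu>. 1 + t * m))" for t
    using fac[of "of_real t"] pos_def_det(2)[OF W]
    by (simp add: mat_scaleR of_real_prod_list o_def)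
  then have "Re (det (W + t *\<^sub>R L)) = Re (det W) * (\<Prod>m\<leftarrow>\<mu>. 1 + t * m)" for t
    by simp
  with pencil_factor_pos[OF W _ fac] tr show thesis
    by (intro that) auto
qed

section \<open>Openness of the cone of positive definite matrices\<close>

lemma pos_def_bounded_below:
  fixes W :: "complex^'k^'k"
  assumes "pos_def W"
  obtains c where "0 < c" "\<And>x. norm x = 1 \<Longrightarrow> c \<le> Re (cinner x (W *v x))"
proof -
  \<comment> \<open>Any coordinate vector shows that the sphere is nonempty, so the continuous form
    attains its minimum on this compact set.\<close>
  have "axis undefined 1 \<in> sphere (0 :: complex^'k) 1" by (simp add: norm_axis_1)
  then have "sphere (0 :: complex^'k) 1 \<noteq> {}" by blast
  moreover have "continuous_on (sphere 0 1) (\<lambda>x. Re (cinner x (W *v x)))"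
    unfolding cinner_def matrix_vector_mult_def by (simp, intro continuous_intros)
  ultimately obtain y where y: "y \<in> sphere 0 1"
    "\<And>x. x \<in> sphere 0 1 \<Longrightarrow> Re (cinner y (W *v y)) \<le> Re (cinner x (W *v x))"
    using continuous_attains_inf[of "sphere 0 1" "\<lambda>x. Re (cinner x (W *v x))"] by auto
  have "y \<noteq> 0" using y(1) by auto
  then have "0 < Re (cinner y (W *v y))"
    using assms by (simp add: pos_def_cinner)
  with y(2) show thesis by (intro that) auto
qed

text \<open>The form is homogeneous of degree 2, so its sign is decided on unit vectors.\<close>

lemma pos_defI_sphere:
  assumes "hermitian M" "\<And>x. norm x = 1 \<Longrightarrow> 0 < Re (cinner x (M *v x))"
  shows "pos_def M"
proof -
  have "0 < Re (cinner x (M *v x))" if "x \<noteq> 0" for x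
  proof -
    define c where "c = complex_of_real (norm x)"
    define y where "y = x /\<^sub>R norm x"
    have "norm y = 1" using that by (simp add: y_def)
    moreover have "x = c *s y"
      using that by (simp add: c_def y_def vec_eq_iff scaleR_conv_of_real[where 'a = complex])
    then have "cinner x (M *v x) = cnj c * (c * cinner y (M *v y))"
      by (simp add: cinner_smult_left cinner_smult_right vector_scalar_commute)
    then have "cinner x (M *v x) = of_real ((norm x)\<^sup>2) * cinner y (M *v y)"
      by (simp add: c_def power2_eq_square)
    then have "Re (cinner x (M *v x)) = (norm x)\<^sup>2 * Re (cinner y (M *v y))"
      by (simp add: Re_complex_of_real)
    ultimately show ?thesis using assms(2) that by simp
  qed
  then show ?thesis using assms(1) by (simp add: pos_def_cinner)
qed

lemma pos_def_perturbation:
  fixes W L :: "complex^'k^'k"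
  assumes W: "pos_def W" and L: "hermitian L"
  obtains e where "0 < e" "\<And>t. \<bar>t\<bar> < e \<Longrightarrow> pos_def (W + t *\<^sub>R L)"
proof -
  obtain c where c: "0 < c" "\<And>x. norm x = 1 \<Longrightarrow> c \<le> Re (cinner x (W *v x))"
    using pos_def_bounded_below[OF W] by metis
  have "continuous_on (sphere 0 1) (\<lambda>x. Re (cinner x (L *v x)))"
    unfolding cinner_def matrix_vector_mult_def by (simp, intro continuous_intros)
  then have "bounded ((\<lambda>x. Re (cinner x (L *v x))) ` sphere 0 1)"
    by (intro compact_imp_bounded compact_continuous_image) auto
  then obtain K where K: "0 < K" "\<And>x. norm x = 1 \<Longrightarrow> \<bar>Re (cinner x (L *v x))\<bar> \<le> K"
    by (auto simp: bounded_pos)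
  show thesis
  proof
    \<comment> \<open>On unit vectors the form of \<open>W\<close> is at least \<open>c\<close> and
      that of \<open>L\<close> at most \<open>K\<close> in modulus, so \<open>c / K\<close> is a
      safe radius.\<close>
    show "0 < c / K" using c(1) K(1) by simp
    fix t :: real assume t: "\<bar>t\<bar> < c / K"
    show "pos_def (W + t *\<^sub>R L)"
    proof (rule pos_defI_sphere)
      show "hermitian (W + t *\<^sub>R L)"
        by (rule hermitian_scaleR_add[OF pos_def_hermitian[OF W] L])
      fix x :: "complex^'k" assume x: "norm x = 1"
      have "\<bar>t * Re (cinner x (L *v x))\<bar> \<le> \<bar>t\<bar> * K"
        unfolding abs_mult using K(2)[OF x] by (intro mult_left_mono) auto
      also have "\<dots> < c" using t K(1) by (simp add: field_simps)
      finally show "0 < Re (cinner x ((W + t *\<^sub>R L) *v x))"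
        unfolding cinner_scaleR_add using c(2)[OF x] by linarith
    qed
  qed
qed

text \<open>Tangent inequality for the concave function \<open>ln det\<close> at \<open>W\<close>:
  the bound \<open>ln (1 + m) \<le> m\<close> is summed over the factors.\<close>

lemma ln_det_le_trace:
  assumes W: "pos_def W" and WL: "pos_def (W + L)"
  shows "ln (Re (det (W + L))) \<le> ln (Re (det W)) + Re (trace (matrix_inv W ** L))"
proof -
  have L: "hermitian L"
    using assms by (auto simp: pos_def_def hermitian_def ctranspose_add)
  obtain \<mu> :: "real list" where
    det: "\<And>t. pos_def (W + t *\<^sub>R L) \<Longrightarrow>
      Re (det (W + t *\<^sub>R L)) = Re (det W) * (\<Prod>m\<leftarrow>\<mu>. 1 + t * m)"
    and pos: "\<And>t m. pos_def (W + t *\<^sub>R L) \<Longrightarrow> m \<in> set \<mu> \<Longrightarrow> 0 < 1 + t * m"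
    and tr: "of_real (sum_list \<mu>) = trace (matrix_inv W ** L)"
    using pos_def_pencil[OF W L] by metis
  have pos: "0 < 1 + m" if "m \<in> set \<mu>" for m
    using pos[of 1] WL that by simp
  have pp: "0 < (\<Prod>m\<leftarrow>\<mu>. 1 + m)" using pos by (intro prod_list_pos) auto
  have "ln (\<Prod>m\<leftarrow>ms. 1 + m) \<le> sum_list ms" if "\<And>m. m \<in> set ms \<Longrightarrow> 0 < 1 + m" for ms :: "real list"
    using that
  proof (induction ms)
    case (Cons a ms)
    have "0 < (\<Prod>m\<leftarrow>ms. 1 + m)" using Cons.prems by (intro prod_list_pos) auto
    moreover have "0 < 1 + a" using Cons.prems by simp
    moreover from this have "ln (1 + a) \<le> a" using ln_le_minus_one[of "1 + a"] by simp
    moreover have "ln (\<Prod>m\<leftarrow>ms. 1 + m) \<le> sum_list ms" using Cons by simp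
    ultimately show ?case using ln_mult_pos[of "1 + a"] by simp
  qed simp
  then have "ln (\<Prod>m\<leftarrow>\<mu>. 1 + m) \<le> Re (trace (matrix_inv W ** L))"
    using pos tr by (metis Re_complex_of_real)
  moreover have "Re (det (W + L)) = Re (det W) * (\<Prod>m\<leftarrow>\<mu>. 1 + m)"
    using det[of 1] WL by simp
  ultimately show ?thesis
    using pp pos_def_det(1)[OF W] by (simp add: ln_mult)
qed

text \<open>The normalised determinant \<open>\<Prod> (1 + t * m)\<close> is 1 at 0 and has the sum
  of \<open>\<mu>\<close> as its derivative there; at a local maximum this derivative
  vanishes.\<close>

lemma trace_zero_if_local_max:
  assumes W: "pos_def W" and L: "hermitian L" and e: "0 < e"
    and max: "\<And>t. \<bar>t\<bar> < e \<Longrightarrow>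
      pos_def (W + t *\<^sub>R L) \<and> Re (det (W + t *\<^sub>R L)) \<le> Re (det W)"
  shows "trace (matrix_inv W ** L) = 0"
proof -
  obtain \<mu> :: "real list" where
    det: "\<And>t. pos_def (W + t *\<^sub>R L) \<Longrightarrow>
      Re (det (W + t *\<^sub>R L)) = Re (det W) * (\<Prod>m\<leftarrow>\<mu>. 1 + t * m)"
    and tr: "of_real (sum_list \<mu>) = trace (matrix_inv W ** L)"
    using pos_def_pencil[OF W L] by metis
  have "(\<Prod>m\<leftarrow>\<mu>. 1 + t * m) \<le> 1" if "\<bar>t\<bar> < e" for t
    using max[OF that] det[of t] pos_def_det(1)[OF W] by simp
  then have "sum_list \<mu> = 0"
    by (intro DERIV_local_max[OF DERIV_prod_list_at_0 e]) (auto simp: map_replicate_const)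
  then show ?thesis using tr by simp
qed

section \<open>Block matrices and controllability\<close>

lemma sum_UNIV_sum_type: "sum f (UNIV :: ('a::finite + 'b::finite) set) = (\<Sum>i\<in>UNIV. f (Inl i)) + (\<Sum>j\<in>UNIV. f (Inr j))"
  by (simp add: UNIV_Plus_UNIV[symmetric] sum.Plus del: UNIV_Plus_UNIV)

lemma ctranspose_hblock: "ctranspose (hblock M N) = vblock (ctranspose M) (ctranspose N)"
  by (auto simp: ctranspose_def hblock_def vblock_def vec_eq_iff split: sum.split)

lemma ctranspose_vblock: "ctranspose (vblock M N) = hblock (ctranspose M) (ctranspose N)"
  by (auto simp: ctranspose_def hblock_def vblock_def vec_eq_iff split: sum.split)

lemma mult_hblock: "K ** hblock M N = hblock (K ** M) (K ** N)"
  by (auto simp: matrix_matrix_mult_def hblock_def vec_eq_iff split: sum.split)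

lemma vblock_mult: "vblock M N ** K = vblock (M ** K) (N ** K)"
  by (auto simp: matrix_matrix_mult_def vblock_def vec_eq_iff split: sum.split)

lemma hblock_mult_vblock: "hblock M N ** vblock K H = M ** K + N ** H"
  by (auto simp: matrix_matrix_mult_def hblock_def vblock_def vec_eq_iff sum_UNIV_sum_type)

lemma vblock_add: "vblock M N + vblock K H = vblock (M + K) (N + H)"
  by (auto simp: vblock_def vec_eq_iff split: sum.split)

lemma hblock_add: "hblock M N + hblock K H = hblock (M + K) (N + H)"
  by (auto simp: hblock_def vec_eq_iff split: sum.split)

lemma vblock_diff: "vblock M N - vblock K H = vblock (M - K) (N - H)"
  by (auto simp: vblock_def vec_eq_iff split: sum.split)

lemma hblock_diff: "hblock M N - hblock K H = hblock (M - K) (N - H)"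
  by (auto simp: hblock_def vec_eq_iff split: sum.split)

lemma vblock_uminus: "- vblock M N = vblock (- M) (- N)"
  by (auto simp: vblock_def vec_eq_iff split: sum.split)

lemma hblock_vblock: "hblock (vblock M N) (vblock K H) = vblock (hblock M K) (hblock N H)"
  by (auto simp: hblock_def vblock_def vec_eq_iff split: sum.split)

lemma mat_1_block: "mat 1 = vblock (hblock (mat 1) 0) (hblock 0 (mat 1))"
  by (auto simp: hblock_def vblock_def mat_def vec_eq_iff split: sum.split)

section \<open>Trace form, row rank and the controllability test\<close>

lemma trace_mult_ctranspose_zero:
  assumes "trace (M ** ctranspose M) = 0"
  shows "M = 0"
proof -
  \<comment> \<open>The trace is the squared Frobenius norm.\<close>
  have "trace (M ** ctranspose M) = of_real (\<Sum>i\<in>UNIV. \<Sum>j\<in>UNIV. (cmod (M $ i $ j))\<^sup>2)"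
    by (simp add: trace_def matrix_matrix_mult_def ctranspose_def complex_norm_square del: of_real_power)
  then have "(\<Sum>i\<in>UNIV. \<Sum>j\<in>UNIV. (cmod (M $ i $ j))\<^sup>2) = 0"
    using assms by (metis of_real_eq_0_iff)
  then have "M $ i $ j = 0" for i j
    by (simp add: sum_nonneg_eq_0_iff sum_nonneg)
  then show ?thesis by (simp add: vec_eq_iff)
qed

text \<open>A nonzero coefficient \<open>w $ k\<close> would express row \<open>k\<close> by the
  other rows, so the row space would have dimension below \<open>CARD('k)\<close>.\<close>

lemma full_row_rank_kernel:
  fixes M :: "'a::field^'l^'k"
  assumes rank: "rank M = CARD('k)" and w: "w v* M = 0"
  shows "w = 0"
proof (rule ccontr)
  assume "w \<noteq> 0"
  then obtain k where k: "w $ k \<noteq> 0" by (metis vec_eq_iff zero_index)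
  have sum0: "(\<Sum>i\<in>UNIV. w $ i *s row i M) = 0"
    using w by (simp add: vector_matrix_mult_def vec_eq_iff row_def mult.commute)
  let ?S = "(\<lambda>i. row i M) ` (UNIV - {k})"
  have "w $ k *s row k M = - (\<Sum>i\<in>UNIV - {k}. w $ i *s row i M)"
    using sum0 by (subst (asm) sum.remove[of _ k]) (auto simp: add_eq_0_iff)
  then have "row k M = (- inverse (w $ k)) *s (\<Sum>i\<in>UNIV - {k}. w $ i *s row i M)"
    using k by (metis (no_types, lifting) add.inverse_inverse vec.scale_minus_left vec.scale_minus_right vec.scale_left_imp_eq vec.scale_scale left_inverse vec.scale_one)
  also have "\<dots> \<in> vec.span ?S"
    by (intro vec.span_scale vec.span_sum vec.span_base) auto
  finally have "rows M \<subseteq> vec.span ?S"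
    by (auto simp: rows_def intro: vec.span_base)
  then have "vec.dim (rows M) \<le> card ?S"
    by (intro vec.dim_le_card) auto
  also have "\<dots> \<le> card (UNIV - {k})" by (rule card_image_le) simp
  also have "\<dots> < CARD('k)" by (simp add: card_Diff_singleton)
  finally show False using rank by (simp add: row_rank_def_gen)
qed

text \<open>Hautus test: no left eigenvector of \<open>A\<close> is annihilated by
  \<open>B\<close>.\<close>

lemma controllable_left_kernel:
  fixes A :: "complex^'n^'n" and B :: "complex^'m^'n"
  assumes "controllable A B" "ctranspose A *v w = z *s w" "ctranspose B *v w = 0"
  shows "w = 0"
proof -
  \<comment> \<open>\<open>v*\<close> does not conjugate, hence the conjugated vector; the rank
    condition is accordingly used at \<open>cnj z\<close>.\<close>
  let ?w = "\<chi> i. cnj (w $ i)"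
  have conj: "?w v* M = (\<chi> i. cnj ((ctranspose M *v w) $ i))" for M :: "complex^'l^'n"
    by (simp add: vec_eq_iff vector_matrix_mult_def matrix_vector_mult_def ctranspose_def mult.commute)
  have "?w v* hblock (mat (cnj z) - A) B = (\<chi> i. cnj ((ctranspose (hblock (mat (cnj z) - A) B) *v w) $ i))"
    by (rule conj)
  also have "ctranspose (hblock (mat (cnj z) - A) B) *v w = 0"
  proof -
    have "ctranspose (mat (cnj z)) = (mat z :: complex^'n^'n)"
      by (auto simp: ctranspose_def mat_def vec_eq_iff)
    then have "(ctranspose (mat (cnj z) - A)) *v w = 0"
      using assms(2) by (simp add: ctranspose_diff matrix_vector_mult_diff_rdistrib mat_vector_mult)
    moreover have "vblock M N *v w = 0" if "M *v w = 0" "N *v w = 0" for M N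
      using that by (auto simp: vblock_def matrix_vector_mult_def vec_eq_iff split: sum.split)
    ultimately show ?thesis using assms(3) by (simp add: ctranspose_hblock)
  qed
  finally have "?w v* hblock (mat (cnj z) - A) B = 0" by (simp add: vec_eq_iff)
  with assms(1) have "?w = 0"
    unfolding controllable_def using full_row_rank_kernel by blast
  then show ?thesis by (simp add: vec_eq_iff)
qed

section \<open>The barrier function at a feasible point\<close>

lemma vblock_kernel:
  assumes "vblock M N *v x = 0"
  shows "M *v x = 0" "N *v x = 0"
proof -
  have "(vblock M N *v x) $ Inl i = 0" "(vblock M N *v x) $ Inr j = 0" for i j
    using assms by simp_all
  then show "M *v x = 0" "N *v x = 0"
    by (simp_all add: vblock_def matrix_vector_mult_def vec_eq_iff)
qed

locale feasible_point =
  fixes A :: "complex^'n^'n" and B :: "complex^'m^'n"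
    and C :: "complex^'n^'m" and D :: "complex^'m^'m"
    and X :: "complex^'n^'n"
  assumes feasible: "X \<in> X_d A B C D"
begin

definition "W = W_d A B C D X"
definition "S = R_mat D - ctranspose B ** X ** B"
definition "F = F_d A B C D X"
definition "P = P_d A B C D X"
definition "AF = A_F_d A B C D X"
text \<open>\<open>V\<close> and \<open>J\<close> are the block columns of the unit triangular
  matrix whose congruence turns \<open>W\<close> into the block diagonal matrix of \<open>P\<close>
  and \<open>S\<close>.\<close>

definition "V = vblock (mat 1) (- F)"
definition J :: "complex^'m^('n + 'm)" where "J = vblock 0 (mat 1)"
text \<open>\<open>E\<close> and \<open>T\<close> express the dependence of \<open>W_d\<close> on
  its argument: a change \<open>\<Delta>\<close> enters as
  \<open>E\<^sup>H \<Delta> E - T\<^sup>H \<Delta> T\<close>.\<close>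

definition E :: "complex^('n + 'm)^'n" where "E = hblock (mat 1) 0"
definition "T = hblock A B"

text \<open>This is the gradient of the barrier at \<open>X\<close> for the trace pairing, as
  \<open>trace_inv_W_L\<close> shows.\<close>

definition G :: "complex^'n^'n" where
  "G = AF ** matrix_inv P ** ctranspose AF - matrix_inv P + B ** matrix_inv S ** ctranspose B"

lemma hermitian_X: "ctranspose X = X"
  using feasible by (simp add: X_d_def hermitian_def)

lemma pos_def_W: "pos_def W"
  using feasible by (simp add: X_d_def W_def)

lemma ctranspose_S: "ctranspose S = S"
  by (simp add: S_def R_mat_def ctranspose_diff ctranspose_add ctranspose_mul hermitian_X
      matrix_mul_assoc add.commute)

lemma W_eq: "W = vblock (hblock (X - ctranspose A ** X ** A) (ctranspose C - ctranspose A ** X ** B))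
    (hblock (C - ctranspose B ** X ** A) S)"
  by (simp add: W_def W_d_def S_def)

text \<open>\<open>S\<close> is the lower right block of \<open>W\<close>, cut out by the injective
  \<open>J\<close>.\<close>

lemma pos_def_S: "pos_def S"
proof -
  have "ctranspose J ** W ** J = S"
    by (simp add: W_eq J_def ctranspose_vblock hblock_mult_vblock vblock_mult mult_hblock hblock_add
        flip: matrix_mul_assoc)
  moreover have "x = 0" if "J *v x = 0" for x
    using vblock_kernel(2)[OF that[unfolded J_def]] by simp
  ultimately show ?thesis using pos_def_congruence[OF pos_def_W, of J] by simp
qed

lemmas inv_S = matrix_inv_mult[OF pos_def_invertible[OF pos_def_S]]

lemma S_F: "S ** F = C - ctranspose B ** X ** A"
  using inv_S by (simp add: F_def F_d_def S_def[symmetric] matrix_mul_assoc)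

lemma F_S: "ctranspose F ** S = ctranspose C - ctranspose A ** X ** B"
proof -
  have "ctranspose F ** S = ctranspose (S ** F)"
    by (simp add: ctranspose_mul ctranspose_S)
  then show ?thesis
    by (simp add: S_F ctranspose_mul ctranspose_diff hermitian_X matrix_mul_assoc)
qed

lemma P_eq: "X - ctranspose A ** X ** A = P + ctranspose F ** S ** F"
  by (simp add: P_def P_d_def F_def S_def)

lemma W_blocks: "W = vblock (hblock (P + ctranspose F ** S ** F) (ctranspose F ** S)) (hblock (S ** F) S)"
  by (simp add: W_eq P_eq S_F F_S)

text \<open>\<open>F\<close> is the feedback for which the lower block of \<open>W ** V\<close>
  cancels, leaving only \<open>P\<close>.\<close>

lemma W_V: "W ** V = vblock P 0"
  by (simp add: W_blocks V_def vblock_mult hblock_mult_vblock matrix_minus_right matrix_mul_assoc)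

lemma W_J: "W ** J = vblock (ctranspose F ** S) S"
  by (simp add: W_blocks J_def vblock_mult hblock_mult_vblock)

text \<open>\<open>P\<close> is the Schur complement of \<open>S\<close> in \<open>W\<close>,
  obtained by congruence with the injective \<open>V\<close>.\<close>

lemma pos_def_P: "pos_def P"
proof -
  have "ctranspose V ** W ** V = P"
    by (simp add: W_V V_def ctranspose_vblock hblock_mult_vblock flip: matrix_mul_assoc)
       (simp add: W_V[unfolded V_def] hblock_mult_vblock)
  moreover have "x = 0" if "V *v x = 0" for x
    using vblock_kernel(1)[OF that[unfolded V_def]] by simp
  ultimately show ?thesis using pos_def_congruence[OF pos_def_W, of V] by simp
qed

lemmas inv_P = matrix_inv_mult[OF pos_def_invertible[OF pos_def_P]]

text \<open>Inverts the block diagonalisation of \<open>W\<close>. After multiplication by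
  \<open>W\<close> the two summands supply the two diagonal blocks of the identity, and the terms
  \<open>ctranspose F\<close> cancel.\<close>

lemma matrix_inv_W:
  "matrix_inv W = V ** matrix_inv P ** ctranspose V + J ** matrix_inv S ** ctranspose J"
proof (rule matrix_inv_unique)
  have "W ** (V ** matrix_inv P ** ctranspose V) = vblock (hblock (mat 1) (- ctranspose F)) 0"
    by (simp add: matrix_mul_assoc W_V vblock_mult inv_P)
       (simp add: V_def ctranspose_vblock ctranspose_uminus)
  moreover have "W ** (J ** matrix_inv S ** ctranspose J) =
      vblock (hblock 0 (ctranspose F)) (hblock 0 (mat 1))"
  proof -
    have "ctranspose F ** S ** matrix_inv S = ctranspose F"
      using inv_S by (simp flip: matrix_mul_assoc)
    then show ?thesis
      by (simp add: matrix_mul_assoc W_J vblock_mult inv_S)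
         (simp add: J_def ctranspose_vblock mult_hblock)
  qed
  ultimately show "W ** (V ** matrix_inv P ** ctranspose V + J ** matrix_inv S ** ctranspose J) = mat 1"
    by (simp add: matrix_add_ldistrib mat_1_block vblock_add hblock_add)
qed

lemma T_V: "T ** V = AF" and T_J: "T ** J = B" and E_V: "E ** V = mat 1" and E_J: "E ** J = 0"
  by (simp_all add: T_def V_def J_def E_def AF_def A_F_d_def F_def[symmetric] hblock_mult_vblock matrix_minus_right)

lemma sandwich_inv_W:
  "K ** matrix_inv W ** ctranspose K =
    (K ** V) ** matrix_inv P ** ctranspose (K ** V) + (K ** J) ** matrix_inv S ** ctranspose (K ** J)"
  by (simp add: matrix_inv_W matrix_add_ldistrib matrix_add_rdistrib ctranspose_mul matrix_mul_assoc)

text \<open>By \<open>T_V\<close>, \<open>T_J\<close>, \<open>E_V\<close> and \<open>E_J\<close>,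
  the sandwich with \<open>T\<close> yields the \<open>AF\<close> and \<open>B\<close> terms and the
  sandwich with \<open>E\<close> yields the inverse of \<open>P\<close>.\<close>

lemma G_eq: "G = T ** matrix_inv W ** ctranspose T - E ** matrix_inv W ** ctranspose E"
  by (simp add: sandwich_inv_W T_V T_J E_V E_J G_def)

lemma ctranspose_G: "ctranspose G = G"
  using hermitian_matrix_inv[OF pos_def_hermitian[OF pos_def_P] pos_def_invertible[OF pos_def_P]]
    hermitian_matrix_inv[OF pos_def_hermitian[OF pos_def_S] pos_def_invertible[OF pos_def_S]]
  by (simp add: G_def ctranspose_add ctranspose_diff ctranspose_mul matrix_mul_assoc)

section \<open>The barrier along a direction and its stationary points\<close>

definition L :: "complex^'n^'n \<Rightarrow> complex^('n + 'm)^('n + 'm)" where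
  "L \<Delta> = ctranspose E ** \<Delta> ** E - ctranspose T ** \<Delta> ** T"

text \<open>\<open>W_d\<close> is affine in its argument, so a line in the space of \<open>X\<close>
  is carried exactly to a Hermitian pencil through \<open>W\<close>.\<close>

lemma W_d_add: "W_d A B C D (X + \<Delta>) = W + L \<Delta>"
proof -
  have "L \<Delta> = vblock (hblock (\<Delta> - ctranspose A ** \<Delta> ** A) (- (ctranspose A ** \<Delta> ** B)))
    (hblock (- (ctranspose B ** \<Delta> ** A)) (- (ctranspose B ** \<Delta> ** B)))"
    by (simp add: L_def E_def T_def ctranspose_hblock vblock_mult mult_hblock vblock_diff hblock_diff)
       (simp add: hblock_vblock vblock_uminus)
  then show ?thesis
    by (simp add: W_def W_d_def vblock_add hblock_add matrix_add_ldistrib matrix_add_rdistrib algebra_simps)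
qed

lemma hermitian_L: "hermitian \<Delta> \<Longrightarrow> hermitian (L \<Delta>)"
  by (simp add: hermitian_def L_def ctranspose_diff ctranspose_mul matrix_mul_assoc)

lemma L_scaleR: "L (t *\<^sub>R \<Delta>) = t *\<^sub>R L \<Delta>"
  by (simp add: L_def matrix_scaleR_mult scaleR_diff_right)

text \<open>Cyclicity of the trace collects the factors \<open>E\<close> and \<open>T\<close> around
  \<open>matrix_inv W\<close>, and \<open>G_eq\<close> applies.\<close>

lemma trace_inv_W_L: "trace (matrix_inv W ** L \<Delta>) = - trace (G ** \<Delta>)"
proof -
  have cyc: "trace (matrix_inv W ** (ctranspose K ** \<Delta> ** K)) = trace ((K ** matrix_inv W ** ctranspose K) ** \<Delta>)"
    for K :: "complex^('n + 'm)^'n"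
    using trace_mul_sym[of "matrix_inv W ** ctranspose K ** \<Delta>" K]
    by (simp add: matrix_mul_assoc)
  show ?thesis
    by (simp add: L_def matrix_diff_ldistrib matrix_diff_rdistrib trace_sub cyc G_eq)
qed

lemma barrier_eq: "barrier_d A B C D (X + \<Delta>) = - ln (Re (det (W + L \<Delta>)))"
  by (simp add: barrier_d_def W_d_add)

lemma barrier_X: "barrier_d A B C D X = - ln (Re (det W))"
  by (simp add: barrier_d_def W_def)

lemma analytic_center_iff: "analytic_center_d A B C D X \<longleftrightarrow> G = 0"
proof
  assume center: "analytic_center_d A B C D X"
  have hG: "hermitian G" using ctranspose_G by (simp add: hermitian_def)
  have pX: "pos_def X" using feasible by (simp add: X_d_def)
  \<comment> \<open>Two radii are needed, since feasibility of \<open>X + t *\<^sub>R G\<close> asks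
    for positive definiteness of both \<open>W_d\<close> and the point itself.\<close>
  obtain e1 where e1: "0 < e1" "\<And>t. \<bar>t\<bar> < e1 \<Longrightarrow> pos_def (W + t *\<^sub>R L G)"
    using pos_def_perturbation[OF pos_def_W hermitian_L[OF hG]] by metis
  obtain e2 where e2: "0 < e2" "\<And>t. \<bar>t\<bar> < e2 \<Longrightarrow> pos_def (X + t *\<^sub>R G)"
    using pos_def_perturbation[OF pX hG] by metis
  have "trace (matrix_inv W ** L G) = 0"
  proof (rule trace_zero_if_local_max[OF pos_def_W hermitian_L[OF hG]])
    show "0 < min e1 e2" using e1 e2 by simp
    fix t assume t: "\<bar>t\<bar> < min e1 e2"
    have pd: "pos_def (W + t *\<^sub>R L G)" using t e1 by simp
    have "X + t *\<^sub>R G \<in> X_d A B C D"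
      using t e2 pd by (simp add: X_d_def W_d_add L_scaleR pos_def_hermitian)
    then have "barrier_d A B C D X \<le> barrier_d A B C D (X + t *\<^sub>R G)"
      using center by (auto simp: analytic_center_d_def is_arg_min_linorder)
    then show "pos_def (W + t *\<^sub>R L G) \<and> Re (det (W + t *\<^sub>R L G)) \<le> Re (det W)"
      using pd pos_def_det(1)[OF pd] pos_def_det(1)[OF pos_def_W]
      by (simp add: barrier_eq barrier_X L_scaleR)
  qed
  then have "trace (G ** ctranspose G) = 0"
    by (simp add: trace_inv_W_L ctranspose_G)
  then show "G = 0" by (rule trace_mult_ctranspose_zero)
next
  assume G: "G = 0"
  \<comment> \<open>The tangent inequality holds at every feasible \<open>Y\<close>, so vanishing of
    the linear term gives a global minimum.\<close>
  have "barrier_d A B C D X \<le> barrier_d A B C D Y" if Y: "Y \<in> X_d A B C D" for Y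
  proof -
    have "pos_def (W + L (Y - X))"
      using Y W_d_add[of "Y - X"] by (simp add: X_d_def)
    from ln_det_le_trace[OF pos_def_W this]
    have "ln (Re (det (W + L (Y - X)))) \<le> ln (Re (det W)) - Re (trace (G ** (Y - X)))"
      by (simp add: trace_inv_W_L)
    also have "trace (G ** (Y - X)) = 0"
      by (simp add: G trace_def)
    finally show ?thesis
      using barrier_eq[of "Y - X"] by (simp add: barrier_X)
  qed
  then show "analytic_center_d A B C D X"
    using feasible by (auto simp: analytic_center_d_def is_arg_min_linorder)
qed

lemma eigenvalue_bound:
  assumes "controllable A B" and G: "G = 0" and ev: "eigenvalue AF z"
  shows "norm z < 1"
proof -
  define Q where "Q = matrix_inv P"
  have pQ: "pos_def Q" unfolding Q_def using pos_def_P by (rule pos_def_matrix_inv)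
  have pN: "pos_def (matrix_inv S)" using pos_def_S by (rule pos_def_matrix_inv)
  obtain w where w: "w \<noteq> 0" "ctranspose AF *v w = cnj z *s w"
    using eigenvalue_ctranspose[OF ev] by (auto simp: eigenvalue_def)
  \<comment> \<open>Otherwise the feedback term drops out and \<open>w\<close> becomes a left
    eigenvector of \<open>A\<close> annihilated by \<open>B\<close>, against
    controllability.\<close>
  have B_w: "ctranspose B *v w \<noteq> 0"
  proof
    assume Bw: "ctranspose B *v w = 0"
    have "ctranspose AF = ctranspose A - ctranspose F ** ctranspose B"
      by (simp add: AF_def A_F_d_def F_def ctranspose_diff ctranspose_mul)
    then have "ctranspose A *v w = cnj z *s w"
      using w(2) Bw by (simp add: matrix_vector_mult_diff_rdistrib flip: matrix_vector_mul_assoc)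
    with assms(1) Bw w(1) show False by (blast dest: controllable_left_kernel)
  qed
  have form: "cinner w ((K ** H ** ctranspose K) *v w) = cinner (ctranspose K *v w) (H *v (ctranspose K *v w))"
    for H :: "complex^'l^'l" and K :: "complex^'l^'n"
    by (simp add: matrix_mul_assoc matrix_vector_mul_assoc flip: cinner_adjoint)
  \<comment> \<open>The equation \<open>G = 0\<close> is evaluated as a quadratic form at
    \<open>w\<close>; the \<open>AF\<close> term then contributes the factor
    \<open>cnj z * z\<close>.\<close>
  have "cinner w ((AF ** Q ** ctranspose AF) *v w) - cinner w (Q *v w)
      + cinner w ((B ** matrix_inv S ** ctranspose B) *v w) = cinner w (G *v w)"
    by (simp add: G_def Q_def matrix_vector_mult_diff_rdistrib matrix_vector_mult_add_rdistrib
        cinner_add_right cinner_diff_right)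
  also have "\<dots> = 0" by (simp add: G cinner_def)
  finally have eq: "cnj z * (z * cinner w (Q *v w)) - cinner w (Q *v w)
      + cinner (ctranspose B *v w) (matrix_inv S *v (ctranspose B *v w)) = 0"
    unfolding form w(2) by (simp add: cinner_smult_left cinner_smult_right vector_scalar_commute)
  define q where "q = Re (cinner w (Q *v w))"
  have q: "0 < q" using pQ w(1) by (simp add: q_def pos_def_cinner)
  have "cnj z * (z * cinner w (Q *v w)) = of_real ((norm z)\<^sup>2) * cinner w (Q *v w)"
    by (simp add: complex_norm_square mult_ac del: of_real_power)
  then have "Re (cnj z * (z * cinner w (Q *v w))) = (norm z)\<^sup>2 * q"
    by (simp only: q_def scaleR_conv_of_real[symmetric] scaleR_complex.sel)
  then have "(norm z)\<^sup>2 * q - q + Re (cinner (ctranspose B *v w) (matrix_inv S *v (ctranspose B *v w))) = 0"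
    using arg_cong[OF eq, of Re] by (simp add: q_def)
  moreover have "0 < Re (cinner (ctranspose B *v w) (matrix_inv S *v (ctranspose B *v w)))"
    using pN B_w by (simp add: pos_def_cinner)
  ultimately have "(norm z)\<^sup>2 * q < 1 * q" by simp
  then have "(norm z)\<^sup>2 < 1" using q by (simp only: mult_less_cancel_right_pos)
  then show ?thesis by (simp add: power_less_one_iff abs_square_less_1)
qed

end

theorem mainTheorem2:
  fixes A :: "complex^'n^'n" and B :: "complex^'m^'n"
    and C :: "complex^'n^'m" and D :: "complex^'m^'m"
    and X :: "complex^'n^'n"
  assumes "minimal_system A B C D"
    and "rank B = CARD('m)" and "rank C = CARD('m)"
    and "X_d A B C D \<noteq> {}"
    and "X \<in> X_d A B C D"
  shows "(analytic_center_d A B C D X \<longleftrightarrow>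
            A_F_d A B C D X ** matrix_inv (P_d A B C D X) ** ctranspose (A_F_d A B C D X)
              - matrix_inv (P_d A B C D X)
              + B ** matrix_inv (R_mat D - ctranspose B ** X ** B) ** ctranspose B = 0)
       \<and> (analytic_center_d A B C D X \<longrightarrow>
            (\<forall>z. eigenvalue (A_F_d A B C D X) z \<longrightarrow> norm z < 1))"
proof -
  interpret feasible_point A B C D X
    by unfold_locales (rule assms(5))
  have "controllable A B" using assms(1) by (simp add: minimal_system_def)
  then show ?thesis
    using analytic_center_iff eigenvalue_bound
    unfolding G_def AF_def P_def S_def by blast
qed

end
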